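(* For every knot $K$, $\text{\"u}(K) \ge 2\,b(K)$, where $\text{\"u}(K)$ is the \"ubercrossing number of $K$ and $b(K)$ is the bridge number of $K$.
   Context: Knots are (tame) knots in 3-space. For $n\ge 2$, an $n$-crossing (multi-crossing) is a point in a planar projection of a knot where $n$ strands, lying at $n$ distinct heights labelled $1,\dots,n$ from top to bottom, cross so that each strand bisects the crossing (that is, each strand goes straight through the point, with the same number of strand ends on each side of it). An \"ubercrossing projection of a knot $K$ is a projection of $K$ with a single multi-crossing (and no other crossings). The \"ubercrossing number $\text{\"u}(K)$ is the smallest $n$ for which $K$ has a projection with a single $n$-crossing. The bridge number $b(K)$ is the usual one: the minimum number of local maxima, with respect to a height function, over all embeddings in the isotopy class of $K$; in particular the unknot has $b=1$. *)

theory Defs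
  imports "HOL-Analysis.Analysis" "HOL-Library.Extended_Nat"
begin

definition ambient_isotopic :: "(real^3) set \<Rightarrow> (real^3) set \<Rightarrow> bool" where
  "ambient_isotopic K L \<longleftrightarrow>
     (\<exists>h. homotopic_with_canon (\<lambda>f. \<exists>g. homeomorphism UNIV UNIV f g) UNIV UNIV id h \<and> h ` K = L)"

definition polygonal :: "(real^3) set \<Rightarrow> bool" where
  "polygonal P \<longleftrightarrow> (\<exists>F. finite F \<and> P = (\<Union>(a, b)\<in>F. closed_segment a b))"

text \<open>Knots are tame: topologically embedded circles that are ambient isotopic to polygonal ones.\<close>

definition knot :: "(real^3) set \<Rightarrow> bool" where
  "knot K \<longleftrightarrow> K homeomorphic sphere (0::complex) 1 \<and> (\<exists>P. polygonal P \<and> ambient_isotopic K P)"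

text \<open>Fixing one direction of projection, which is also the height direction, loses no
  generality, since both invariants below range over a whole isotopy class.\<close>

definition planar_proj :: "real^3 \<Rightarrow> real^2" where
  "planar_proj p = vector [p $ 1, p $ 2]"

definition height :: "real^3 \<Rightarrow> real" where
  "height p = p $ 3"

text \<open>That every strand bisects the crossing is expressed in a chart \<open>\<phi>\<close> of the plane taking a
  neighbourhood \<open>U\<close> of \<open>c\<close> to the open unit disc and \<open>c\<close> to its centre: the part of \<open>K\<close> above \<open>U\<close>
  consists of the strands \<open>s 1, \<dots>, s n\<close>, numbered from top to bottom at the crossing, and strand
  \<open>s i\<close> projects injectively onto the diameter in direction \<open>u i\<close>, where distinct strands have
  distinct diameters. So each strand runs straight through the centre and leaves one end of
  every other strand on either side. The strands are parametrized by the open interval from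
  \<open>-1\<close> to \<open>1\<close> and need not be horizontal.\<close>

definition multi_crossing :: "nat \<Rightarrow> (real^3) set \<Rightarrow> real^2 \<Rightarrow> bool" where
  "multi_crossing n K c \<longleftrightarrow> n \<ge> 2 \<and>
     (\<exists>U \<phi> \<psi> (u :: nat \<Rightarrow> real^2) (s :: nat \<Rightarrow> real \<Rightarrow> real^3).
        open U \<and> c \<in> U \<and> homeomorphism U (ball (0 :: real^2) 1) \<phi> \<psi> \<and> \<phi> c = 0 \<and>
        (\<forall>i\<in>{1..n}. norm (u i) = 1) \<and>
        (\<forall>i\<in>{1..n}. \<forall>j\<in>{1..n}. i \<noteq> j \<longrightarrow> u i \<noteq> u j \<and> u i \<noteq> - u j) \<and>
        (\<forall>i\<in>{1..n}. continuous_on {-1<..<1} (s i)) \<and>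
        (\<forall>i\<in>{1..n}. \<forall>t\<in>{-1<..<1}. \<phi> (planar_proj (s i t)) = t *\<^sub>R u i) \<and>
        K \<inter> planar_proj -` U = (\<Union>i\<in>{1..n}. s i ` {-1<..<1}) \<and>
        (\<forall>i\<in>{1..n}. \<forall>j\<in>{1..n}. i < j \<longrightarrow> height (s j 0) < height (s i 0)))"

definition ubercrossing_projection :: "nat \<Rightarrow> (real^3) set \<Rightarrow> bool" where
  "ubercrossing_projection n K \<longleftrightarrow>
     (\<exists>c. multi_crossing n K c \<and> inj_on planar_proj (K - planar_proj -` {c}))"

text \<open>Both invariants are taken in \<^typ>\<open>enat\<close>, where the infimum of a nonempty set is its minimum
  and the infimum of the empty set is \<open>\<infinity>\<close> (for natural numbers it would be \<open>0\<close>).\<close>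

definition ubercrossing_number :: "(real^3) set \<Rightarrow> enat" where
  "ubercrossing_number K =
     (INF n \<in> {n. \<exists>L. ambient_isotopic K L \<and> ubercrossing_projection n L}. enat n)"

text \<open>Local maxima are not required to be strict, so that a plateau counts as infinitely many of
  them instead of being overlooked.\<close>

definition local_maxima :: "(real^3) set \<Rightarrow> (real^3) set" where
  "local_maxima K = {p \<in> K. \<forall>\<^sub>F q in at p within K. height q \<le> height p}"

definition bridge_number :: "(real^3) set \<Rightarrow> enat" where
  "bridge_number K =
     (INF L \<in> {L. ambient_isotopic K L \<and> finite (local_maxima L)}. enat (card (local_maxima L)))"

end

theory Submission
  imports Defs
begin

text \<open>Travelling once around a projection with a single \<open>n\<close>-crossing, one meets the \<open>n\<close> strands in some
  cyclic order, with pairwise distinct heights \<open>v 0, \<dots>, v (n - 1)\<close> at the crossing point. Away from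
  the crossing the projection is injective, so the heights there carry no knotting information: they
  can be changed at will, for instance so that they vary linearly, hence monotonically, from each
  value \<open>v k\<close> to the next. After this change a local maximum can only occur at a strand whose
  height exceeds that of both its cyclic neighbours. No two consecutive strands have this property,
  so there are at most \<open>n / 2\<close> local maxima.

  The change of heights is an ambient isotopy because it leaves the heights over the crossing
  point alone. Then the difference between the new height and the old one is the same
  at any two points of the knot with the same projection: it vanishes over the crossing point, and over
  every other point of the plane there is at most one point of the knot. So the difference is a
  continuous function on the projection of the knot, which is compact, and by Tietze's theorem it
  extends to a continuous function \<open>F\<close> on the whole plane
  (\<open>vertical_shear_with_prescribed_heights\<close>). Moving every point of space vertically by
  \<open>t * F\<close> of its projection, for \<open>t\<close> from \<open>0\<close> to \<open>1\<close>, is the desired isotopy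
  (\<open>ambient_isotopic_vertical_shear\<close>).

  For the count the knot is parametrized as a loop that starts at the lowest point over the crossing
  (\<open>homeomorphic_circle_imp_loop\<close>). The base point is then not a local maximum, and only the
  strands between start and end need attention (\<open>local_maxima_piecewise_linear\<close>,
  \<open>two_card_peaks_le\<close>).\<close>

section \<open>Ambient isotopies\<close>

text \<open>The second isotopy is run after the first one has ended, precomposed with the final
  homeomorphism of the first.\<close>

lemma ambient_isotopic_trans:
  assumes "ambient_isotopic K L" "ambient_isotopic L M"
  shows "ambient_isotopic K M"
proof -
  let ?P = "\<lambda>f :: real^3 \<Rightarrow> real^3. \<exists>g. homeomorphism UNIV UNIV f g"
  obtain h where h: "homotopic_with_canon ?P UNIV UNIV id h" "h ` K = L"
    using assms(1) unfolding ambient_isotopic_def by blast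
  obtain k where k: "homotopic_with_canon ?P UNIV UNIV id k" "k ` L = M"
    using assms(2) unfolding ambient_isotopic_def by blast
  obtain h' where h': "homeomorphism UNIV UNIV h h'"
    using homotopic_with_imp_property[OF h(1)] by blast
  have "homotopic_with_canon ?P UNIV UNIV (id \<circ> h) (k \<circ> h)"
  proof (rule homotopic_with_compose_continuous_map_right[OF k(1)])
    show "continuous_map (top_of_set UNIV) (top_of_set UNIV) h"
      using h' by (simp add: homeomorphism_def)
  next
    fix f :: "real^3 \<Rightarrow> real^3" assume "?P f"
    then show "?P (f \<circ> h)"
      using homeomorphism_compose[OF h'] by blast
  qed
  then have "homotopic_with_canon ?P UNIV UNIV id (k \<circ> h)"
    using homotopic_with_trans[OF h(1)] by simp
  moreover have "(k \<circ> h) ` K = M"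
    using h(2) k(2) by (auto simp: image_comp)
  ultimately show ?thesis
    unfolding ambient_isotopic_def by blast
qed

lemma ambient_isotopic_imp_homeomorphic:
  assumes "ambient_isotopic K L"
  shows "K homeomorphic L"
proof -
  obtain h where h: "homotopic_with_canon (\<lambda>f. \<exists>g. homeomorphism UNIV UNIV f g) UNIV UNIV id h"
      "h ` K = L"
    using assms unfolding ambient_isotopic_def by blast
  obtain h' where "homeomorphism UNIV UNIV h h'"
    using homotopic_with_imp_property[OF h(1)] by blast
  then have "homeomorphism K L h h'"
    using h(2) by (intro homeomorphism_of_subsets[of UNIV UNIV h h' K UNIV L]) auto
  then show ?thesis
    unfolding homeomorphic_def by blast
qed

definition vertical_shear :: "(real^2 \<Rightarrow> real) \<Rightarrow> real^3 \<Rightarrow> real^3" where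
  "vertical_shear F p = p + F (planar_proj p) *\<^sub>R axis 3 1"

lemma planar_proj_vertical_shear [simp]: "planar_proj (vertical_shear F p) = planar_proj p"
  by (simp add: planar_proj_def vertical_shear_def axis_def)

lemma height_vertical_shear [simp]: "height (vertical_shear F p) = height p + F (planar_proj p)"
  by (simp add: height_def vertical_shear_def)

lemma continuous_on_planar_proj [continuous_intros]:
  "continuous_on S f \<Longrightarrow> continuous_on S (\<lambda>x. planar_proj (f x))"
proof -
  assume f: "continuous_on S f"
  have *: "planar_proj p = p $ 1 *\<^sub>R axis 1 1 + p $ 2 *\<^sub>R axis 2 1" for p
    by (simp add: planar_proj_def vec_eq_iff forall_2 axis_def)
  show ?thesis
    unfolding * by (intro continuous_intros f)
qed

lemma continuous_on_height [continuous_intros]: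
  "continuous_on S f \<Longrightarrow> continuous_on S (\<lambda>x. height (f x))"
  unfolding height_def by (intro continuous_intros)

lemma continuous_on_vertical_shear:
  assumes "continuous_on UNIV F"
  shows "continuous_on S (vertical_shear F)"
  unfolding vertical_shear_def
  by (intro continuous_intros continuous_on_compose2[OF assms]) auto

text \<open>A shear does not change the projection, so shearing by \<open>- F\<close> undoes shearing by \<open>F\<close>.\<close>

lemma homeomorphism_vertical_shear:
  assumes "continuous_on UNIV F"
  shows "homeomorphism UNIV UNIV (vertical_shear F) (vertical_shear (\<lambda>x. - F x))"
proof (rule homeomorphismI)
  show "continuous_on UNIV (vertical_shear F)" "continuous_on UNIV (vertical_shear (\<lambda>x. - F x))"
    by (intro continuous_on_vertical_shear continuous_intros assms)+
  have "vertical_shear (\<lambda>x. - f x) (vertical_shear f p) = p" for f p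
    using planar_proj_vertical_shear[of f p] by (simp add: vertical_shear_def)
  from this this[of "\<lambda>x. - F x"]
  show "vertical_shear (\<lambda>x. - F x) (vertical_shear F p) = p"
       "vertical_shear F (vertical_shear (\<lambda>x. - F x) p) = p" for p
    by simp_all
qed auto

lemma ambient_isotopic_vertical_shear:
  assumes F: "continuous_on UNIV F"
  shows "ambient_isotopic K (vertical_shear F ` K)"
  unfolding ambient_isotopic_def
proof (intro exI[of _ "vertical_shear F"] conjI refl)
  let ?k = "\<lambda>(t, p). vertical_shear (\<lambda>x. t * F x) p"
  have "continuous_on ({0..1} \<times> UNIV) ?k"
    unfolding vertical_shear_def case_prod_unfold
    by (intro continuous_intros continuous_on_compose2[OF F]) auto
  then have k: "continuous_map (prod_topology (top_of_set {0..1}) (top_of_set UNIV)) (top_of_set UNIV) ?k"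
    unfolding prod_topology_subtopology_eu by simp
  have "homeomorphism UNIV UNIV (\<lambda>p. ?k (t, p)) (vertical_shear (\<lambda>x. - (t * F x)))" for t
    using homeomorphism_vertical_shear[of "\<lambda>x. t * F x"]
    by (simp add: continuous_on_mult F)
  then have "\<forall>t\<in>{0..1}. \<exists>g. homeomorphism UNIV UNIV (\<lambda>p. ?k (t, p)) g"
    by blast
  moreover have "\<forall>p. ?k (0, p) = id p" "\<forall>p. ?k (1, p) = vertical_shear F p"
    by (simp_all add: vertical_shear_def)
  ultimately show "homotopic_with_canon (\<lambda>f. \<exists>g. homeomorphism UNIV UNIV f g) UNIV UNIV id
                     (vertical_shear F)"
    unfolding homotopic_with_def using k by blast
qed

text \<open>A new height \<open>H\<close> along a compact curve is realized by a shear as soon as the displacement depends on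
  the projected point only: a continuous surjection from a compact space is a quotient map, so the
  displacement descends to the projection of the curve, and from there it extends to the plane.\<close>

lemma vertical_shear_with_prescribed_heights:
  fixes \<gamma> :: "real \<Rightarrow> real^3" and H :: "real \<Rightarrow> real"
  assumes \<gamma>: "continuous_on S \<gamma>" and H: "continuous_on S H" and S: "compact S"
    and fibre: "\<And>x y. x \<in> S \<Longrightarrow> y \<in> S \<Longrightarrow> planar_proj (\<gamma> x) = planar_proj (\<gamma> y) \<Longrightarrow>
                  H x - height (\<gamma> x) = H y - height (\<gamma> y)"
  obtains F where "continuous_on UNIV F"
    "\<And>x. x \<in> S \<Longrightarrow> height (vertical_shear F (\<gamma> x)) = H x"
proof -
  define q where "q = (\<lambda>x. planar_proj (\<gamma> x))"
  have q: "continuous_on S q"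
    unfolding q_def by (intro continuous_intros \<gamma>)
  have "quotient_map (top_of_set S) (top_of_set (q ` S)) q"
    using q S by (intro T1_Spaces.continuous_imp_quotient_map)
      (auto simp: compact_space_subtopology Hausdorff_space_subtopology)
  then obtain f where f: "continuous_map (top_of_set (q ` S)) euclideanreal f"
      "\<And>x. x \<in> S \<Longrightarrow> f (q x) = H x - height (\<gamma> x)"
  proof (rule quotient_map_lift_exists)
    show "continuous_map (top_of_set S) euclideanreal (\<lambda>x. H x - height (\<gamma> x))"
      using \<gamma> H by (simp add: continuous_on_diff continuous_on_height)
  next
    fix x y assume "x \<in> topspace (top_of_set S)" "y \<in> topspace (top_of_set S)" "q x = q y"
    then show "H x - height (\<gamma> x) = H y - height (\<gamma> y)"
      using fibre[of x y] by (simp add: q_def)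
  qed (rule that, simp_all)
  have "closed (q ` S)"
    using compact_continuous_image[OF q S] by (rule compact_imp_closed)
  then obtain F where F: "continuous_on UNIV F" "\<And>z. z \<in> q ` S \<Longrightarrow> F z = f z"
    using Tietze_unbounded[of "q ` S" f UNIV] f(1) by auto
  have "height (vertical_shear F (\<gamma> x)) = H x" if "x \<in> S" for x
    using f(2)[OF that] F(2)[of "q x"] that by (simp add: q_def)
  then show thesis
    using that F(1) by blast
qed

section \<open>Circles as loops\<close>

text \<open>The base point can be prescribed because the circle can be rotated.\<close>

lemma homeomorphic_circle_imp_loop:
  fixes L :: "'a::t2_space set"
  assumes L: "L homeomorphic sphere (0::complex) 1" and p: "p \<in> L"
  obtains \<gamma> :: "real \<Rightarrow> 'a" where "continuous_on {0..1} \<gamma>" "\<gamma> ` {0..1} = L" "\<gamma> 0 = p" "\<gamma> 1 = p"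
    "inj_on \<gamma> {0..<1}"
proof -
  obtain f g where fg: "homeomorphism L (sphere (0::complex) 1) f g"
    using L unfolding homeomorphic_def by blast
  have fp: "norm (f p) = 1"
    using fg p unfolding homeomorphism_def by auto
  define \<gamma> where "\<gamma> = (\<lambda>x::real. g (f p * cis (2 * pi * x)))"
  show thesis
  proof
    have cg: "continuous_on (sphere 0 1) g"
      using fg by (simp add: homeomorphism_def)
    show "continuous_on {0..1} \<gamma>"
      unfolding \<gamma>_def cis_conv_exp
      by (intro continuous_on_compose2[OF cg] continuous_intros)
         (auto simp: norm_mult fp)
    show "\<gamma> 0 = p" "\<gamma> 1 = p"
      using fg p by (auto simp: \<gamma>_def homeomorphism_def)
    show "\<gamma> ` {0..1} = L"
    proof
      show "\<gamma> ` {0..1} \<subseteq> L"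
        using fg by (auto simp: \<gamma>_def homeomorphism_def norm_mult fp)
      show "L \<subseteq> \<gamma> ` {0..1}"
      proof
        fix y assume y: "y \<in> L"
        define z where "z = f y / f p"
        have nz: "norm z = 1"
          using fg y fp by (force simp: z_def norm_divide homeomorphism_def)
        have "cis (Arg2pi z) = z"
          using complex_norm_eq_1_exp[of z] nz by (simp add: cis_conv_exp)
        then have "\<gamma> (Arg2pi z / (2 * pi)) = g (f p * z)"
          by (simp add: \<gamma>_def)
        also have "\<dots> = y"
          using fg y fp by (auto simp: z_def homeomorphism_def)
        finally show "y \<in> \<gamma> ` {0..1}"
          using Arg2pi[of z] by (intro image_eqI[of _ _ "Arg2pi z / (2 * pi)"]) auto
      qed
    qed
    show "inj_on \<gamma> {0..<1}"
    proof (rule inj_onI)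
      fix x y :: real assume xy: "x \<in> {0..<1}" "y \<in> {0..<1}" "\<gamma> x = \<gamma> y"
      have "f (\<gamma> t) = f p * cis (2 * pi * t)" for t
        using fg by (auto simp: \<gamma>_def homeomorphism_def norm_mult fp)
      with xy(3) have "f p * cis (2 * pi * x) = f p * cis (2 * pi * y)"
        by metis
      then have eq: "cis (2 * pi * x) = cis (2 * pi * y)"
        using fp by (metis mult_left_cancel norm_zero zero_neq_one)
      have "Arg2pi (cis (2 * pi * t)) = 2 * pi * t" if "t \<in> {0..<1}" for t
        using that by (intro Arg2pi_unique[of 1]) (auto simp: cis_conv_exp)
      then have "2 * pi * x = 2 * pi * y"
        using xy(1,2) eq by metis
      then show "x = y"
        by simp
    qed
  qed
qed

section \<open>Piecewise linear heights\<close>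

lemma finite_increasing_enumeration:
  fixes T :: "'a::linorder set"
  assumes "finite T" "card T = Suc n" "a \<in> T" "b \<in> T" "T \<subseteq> {a..b}"
  obtains t where "strict_mono_on {..n} t" "t ` {..n} = T" "t 0 = a" "t n = b"
proof -
  define t where "t = (\<lambda>k. sorted_list_of_set T ! k)"
  have len: "length (sorted_list_of_set T) = Suc n"
    using assms by simp
  have mono: "strict_mono_on {..n} t"
    unfolding t_def
    by (intro strict_mono_onI sorted_wrt_nth_less[OF strict_sorted_list_of_set])
       (use len in auto)
  have img: "t ` {..n} = T"
  proof -
    have "t ` {..n} = set (sorted_list_of_set T)"
      unfolding t_def set_conv_nth len by (auto simp: less_Suc_eq_le)
    then show ?thesis
      using assms(1) by simp
  qed
  have le: "t i \<le> t j" if "i \<le> j" "j \<le> n" for i j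
    using strict_mono_on_leD[OF mono] that by auto
  obtain i j where ij: "i \<le> n" "t i = a" "j \<le> n" "t j = b"
    using assms img by (metis atMost_iff imageE)
  have "t 0 \<in> {a..b}" "t n \<in> {a..b}"
    using img assms(5) by auto
  then have "t 0 = a" "t n = b"
    using le[of 0 i] le[of j n] ij by auto
  with mono img show thesis
    using that by blast
qed

lemma piecewise_linear_interpolation:
  fixes t v :: "nat \<Rightarrow> real"
  assumes "strict_mono_on {..n} t"
  obtains H where "continuous_on UNIV H" "\<And>k. k \<le> n \<Longrightarrow> H (t k) = v k"
    "\<And>k x. k < n \<Longrightarrow> x \<in> {t k..t (Suc k)} \<Longrightarrow>
       H x = v k + (v (Suc k) - v k) * ((x - t k) / (t (Suc k) - t k))"
proof -
  have "\<exists>H. continuous_on UNIV H \<and> (\<forall>k\<le>n. H (t k) = v k) \<and>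
          (\<forall>k<n. \<forall>x\<in>{t k..t (Suc k)}.
             H x = v k + (v (Suc k) - v k) * ((x - t k) / (t (Suc k) - t k)))"
    using assms
  proof (induction n)
    case 0
    show ?case
      by (intro exI[of _ "\<lambda>_. v 0"]) auto
  next
    case (Suc n)
    have "strict_mono_on {..n} t"
      using Suc.prems by (rule monotone_on_subset) auto
    then obtain H where H: "continuous_on UNIV H" "\<And>k. k \<le> n \<Longrightarrow> H (t k) = v k"
      "\<And>k x. k < n \<Longrightarrow> x \<in> {t k..t (Suc k)} \<Longrightarrow>
         H x = v k + (v (Suc k) - v k) * ((x - t k) / (t (Suc k) - t k))"
      using Suc.IH by blast
    define A where "A = (\<lambda>x. v n + (v (Suc n) - v n) * ((x - t n) / (t (Suc n) - t n)))"
    define H' where "H' = (\<lambda>x. if x \<le> t n then H x else A x)"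
    have lt: "t n < t (Suc n)"
      using strict_mono_onD[OF Suc.prems] by auto
    have le: "t k \<le> t n" if "k \<le> n" for k
      using strict_mono_on_leD[OF Suc.prems] that by auto
    have A: "A (t n) = v n" "A (t (Suc n)) = v (Suc n)"
      using lt by (auto simp: A_def)
    have "continuous_on UNIV H'"
      unfolding H'_def
    proof (rule continuous_on_cases_le)
      show "continuous_on {x \<in> UNIV. x \<le> t n} H"
        using H(1) by (rule continuous_on_subset) auto
      show "continuous_on {x \<in> UNIV. t n \<le> x} A"
        unfolding A_def using lt by (auto intro!: continuous_intros)
    qed (use H(2)[of n] A in auto)
    moreover have "H' (t k) = v k" if "k \<le> Suc n" for k
      using that le[of k] H(2)[of k] lt A by (auto simp: H'_def le_Suc_eq)
    moreover have "H' x = v k + (v (Suc k) - v k) * ((x - t k) / (t (Suc k) - t k))"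
      if "k < Suc n" "x \<in> {t k..t (Suc k)}" for k x
    proof (cases "k = n")
      case True
      then show ?thesis
        using that A H(2)[of n] by (cases "x = t n") (auto simp: H'_def A_def)
    next
      case False
      then show ?thesis
        using that H(3)[of k x] le[of "Suc k"] by (auto simp: H'_def)
    qed
    ultimately show ?case
      by blast
  qed
  then show thesis
    using that by blast
qed

text \<open>For a cyclic sequence \<open>v 0, \<dots>, v n = v 0\<close> that starts at its minimum, these are all the strict cyclic
  local maxima.\<close>

definition peaks :: "nat \<Rightarrow> (nat \<Rightarrow> 'a::linorder) \<Rightarrow> nat set" where
  "peaks n v = {k \<in> {1..<n}. v (k - 1) < v k \<and> v (Suc k) < v k}"

text \<open>The predecessor of a peak is not a peak, so the peaks and their predecessors are disjoint subsets
  of \<open>{..<n}\<close>.\<close>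

lemma two_card_peaks_le: "2 * card (peaks n v) \<le> n"
proof -
  have fin: "finite (peaks n v)"
    unfolding peaks_def by simp
  have inj: "inj_on (\<lambda>k. k - 1) (peaks n v)"
    by (rule inj_onI) (auto simp: peaks_def)
  have disj: "peaks n v \<inter> (\<lambda>k. k - 1) ` peaks n v = {}"
  proof (rule ccontr)
    assume "peaks n v \<inter> (\<lambda>k. k - 1) ` peaks n v \<noteq> {}"
    then obtain k where k: "k \<in> peaks n v" "k - 1 \<in> peaks n v"
      by blast
    then have "Suc (k - 1) = k"
      by (auto simp: peaks_def)
    then show False
      using k by (auto simp: peaks_def)
  qed
  have "2 * card (peaks n v) = card (peaks n v \<union> (\<lambda>k. k - 1) ` peaks n v)"
    using fin disj by (simp add: card_Un_disjoint card_image[OF inj] del: One_nat_def)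
  also have "\<dots> \<le> card {..<n}"
    by (intro card_mono) (auto simp: peaks_def)
  finally show ?thesis
    by simp
qed

text \<open>Parameters near \<open>x\<close> have images near \<open>G x\<close>. Those with \<open>G y = G x\<close>, which the punctured
  neighbourhood of \<open>G x\<close> does not cover, satisfy the inequality trivially.\<close>

lemma local_maxima_imageD:
  assumes G: "continuous_on S G" and x: "x \<in> S" and max: "G x \<in> local_maxima (G ` S)"
  shows "\<forall>\<^sub>F y in at x within S. height (G y) \<le> height (G x)"
proof -
  obtain U where U: "open U" "G x \<in> U"
      "\<And>q. q \<in> U \<Longrightarrow> q \<noteq> G x \<Longrightarrow> q \<in> G ` S \<Longrightarrow> height q \<le> height (G x)"
    using max unfolding local_maxima_def eventually_at_topological by auto
  have "(G \<longlongrightarrow> G x) (at x within S)"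
    using G x unfolding continuous_on_def by blast
  then have "\<forall>\<^sub>F y in at x within S. G y \<in> U"
    using U(1,2) by (rule topological_tendstoD)
  moreover have "\<forall>\<^sub>F y in at x within S. y \<in> S"
    by (simp add: eventually_at_topological) blast
  ultimately show ?thesis
    by eventually_elim (use U(3) in \<open>metis imageI order_refl\<close>)
qed

lemma eventually_le_linearD:
  fixes h :: "real \<Rightarrow> real"
  assumes ev: "\<forall>\<^sub>F y in at x within {a..b}. h y \<le> h x"
    and lin: "\<And>y. y \<in> {a..b} \<Longrightarrow> h y = c + m * (y - a)"
    and ab: "a < b" and x: "x \<in> {a..b}"
  shows "x < b \<Longrightarrow> m \<le> 0" "a < x \<Longrightarrow> 0 \<le> m"
proof -
  obtain d where d: "d > 0"
      "\<And>y. y \<in> {a..b} \<Longrightarrow> y \<noteq> x \<Longrightarrow> dist y x < d \<Longrightarrow> h y \<le> h x"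
    using ev unfolding eventually_at by auto
  show "m \<le> 0" if "x < b"
  proof -
    define y where "y = min b (x + d / 2)"
    have y: "x < y" "y \<in> {a..b}" "dist y x < d"
      using that x d(1) by (auto simp: y_def dist_real_def)
    then have "h y \<le> h x"
      using d(2)[of y] by auto
    then have "m * (y - x) \<le> 0"
      using lin[OF y(2)] lin[OF x] by (simp add: algebra_simps)
    then show ?thesis
      using y(1) by (simp add: mult_le_0_iff)
  qed
  show "0 \<le> m" if "a < x"
  proof -
    define y where "y = max a (x - d / 2)"
    have y: "y < x" "y \<in> {a..b}" "dist y x < d"
      using that x d(1) by (auto simp: y_def dist_real_def)
    then have "h y \<le> h x"
      using d(2)[of y] by auto
    then have "0 \<le> m * (x - y)"
      using lin[OF y(2)] lin[OF x] by (simp add: algebra_simps)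
    then show ?thesis
      using y(1) by (simp add: zero_le_mult_iff)
  qed
qed

text \<open>A local maximum in the interior of a piece would make the slope there both nonnegative and
  nonpositive, but it is nonzero. At a breakpoint the pieces on either side must rise towards it. The
  common endpoint is excluded because the first piece rises away from it.\<close>

lemma local_maxima_piecewise_linear:
  fixes t v :: "nat \<Rightarrow> real"
  assumes t: "strict_mono_on {..n} t" "t 0 = a" "t n = b"
    and G: "continuous_on {a..b} G" "G a = G b"
    and v: "\<And>k. k < n \<Longrightarrow> v k \<noteq> v (Suc k)"
    and low: "v 0 < v 1" 
    and lin: "\<And>k x. k < n \<Longrightarrow> x \<in> {t k..t (Suc k)} \<Longrightarrow>
       height (G x) = v k + (v (Suc k) - v k) * ((x - t k) / (t (Suc k) - t k))"
    and n: "0 < n"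
  shows "local_maxima (G ` {a..b}) \<subseteq> G ` t ` peaks n v"
proof
  fix p assume p: "p \<in> local_maxima (G ` {a..b})"
  then have "p \<in> G ` {a..b}"
    by (simp add: local_maxima_def)
  have "a < b"
    using strict_mono_onD[OF t(1), of 0 n] t n by auto
  obtain x where x: "x \<in> {a..<b}" "p = G x"
  proof -
    obtain y where y: "y \<in> {a..b}" "p = G y"
      using \<open>p \<in> G ` {a..b}\<close> by blast
    show thesis
      using that[of y] that[of a] y G(2) \<open>a < b\<close> by (cases "y = b") auto
  qed
  have ev: "\<forall>\<^sub>F y in at x within {a..b}. height (G y) \<le> height (G x)"
    using local_maxima_imageD[OF G(1)] p x by auto
  have tt: "t i < t j" if "i < j" "j \<le> n" for i j
    using strict_mono_onD[OF t(1), of i j] that by auto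
  have slope: "(x < t (Suc k) \<longrightarrow> v (Suc k) < v k) \<and> (t k < x \<longrightarrow> v k < v (Suc k))"
    if k: "k < n" "x \<in> {t k..t (Suc k)}" for k
  proof -
    have d: "t k < t (Suc k)"
      using tt k(1) by auto
    have "t 0 \<le> t k" "t (Suc k) \<le> t n"
      using k(1) by (auto intro!: strict_mono_on_leD[OF t(1)])
    then have ev': "\<forall>\<^sub>F y in at x within {t k..t (Suc k)}. height (G y) \<le> height (G x)"
      using ev unfolding t(2,3) by (elim filter_leD[OF at_le, rotated]) auto
    define m where "m = (v (Suc k) - v k) / (t (Suc k) - t k)"
    have "height (G y) = v k + m * (y - t k)" if "y \<in> {t k..t (Suc k)}" for y
      using lin[OF k(1) that] by (simp add: m_def)
    from eventually_le_linearD[OF ev' this d k(2)]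
    show ?thesis
      using d v[OF k(1)] by (auto simp: m_def divide_le_0_iff zero_le_divide_iff)
  qed
  obtain k where k: "k < n" "t k \<le> x" "x < t (Suc k)"
  proof -
    \<comment> \<open>Choosing the piece half-open on the right makes a breakpoint the left end of its piece.\<close>
    define k where "k = (LEAST k. x < t (Suc k))"
    have ex: "x < t (Suc (n - 1))"
      using x t n by simp
    have 1: "x < t (Suc k)"
      unfolding k_def using ex by (rule LeastI)
    have 2: "k \<le> n - 1"
      unfolding k_def using ex by (rule Least_le)
    have 3: "t k \<le> x"
    proof (cases k)
      case 0
      then show ?thesis
        using x t by simp
    next
      case (Suc j)
      then show ?thesis
        using not_less_Least[of j "\<lambda>k. x < t (Suc k)"] by (auto simp: k_def)
    qed
    show thesis
      using that[of k] 1 2 3 n by auto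
  qed
  from slope[of k] k have vk: "v (Suc k) < v k" and "x = t k"
    by (auto dest: order.asym simp: le_less)
  moreover have "0 < k"
    using vk low by (cases k) auto
  moreover have "v (k - 1) < v k"
    using slope[of "k - 1"] tt[of "k - 1" k] \<open>x = t k\<close> \<open>0 < k\<close> k(1) by auto
  ultimately show "p \<in> G ` t ` peaks n v"
    using k(1) x(2) by (auto simp: peaks_def)
qed

section \<open>The bound\<close>

text \<open>In the chart the crossing point is the origin, and a strand, running along a diameter with unit
  direction vector, is over the origin only at parameter \<open>0\<close>.\<close>

lemma multi_crossing_fibre:
  assumes "multi_crossing n K c"
  shows "2 \<le> n" "card (K \<inter> planar_proj -` {c}) = n" "inj_on height (K \<inter> planar_proj -` {c})"
proof -
  obtain U \<phi> \<psi> u s where n: "n \<ge> 2" and U: "c \<in> U"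
    and \<phi>: "homeomorphism U (ball (0 :: real^2) 1) \<phi> \<psi>" "\<phi> c = 0"
    and u: "\<forall>i\<in>{1..n}. norm (u i :: real^2) = 1"
    and s: "\<forall>i\<in>{1..n}. \<forall>t\<in>{-1<..<1}. \<phi> (planar_proj (s i t)) = t *\<^sub>R u i"
    and K: "K \<inter> planar_proj -` U = (\<Union>i\<in>{1..n}. s i ` {-1<..<1})"
    and h: "\<forall>i\<in>{1..n}. \<forall>j\<in>{1..n}. i < j \<longrightarrow> height (s j 0) < height (s i 0)"
    using assms unfolding multi_crossing_def by (elim conjE exE) (rule that)
  have fib: "K \<inter> planar_proj -` {c} = (\<lambda>i. s i 0) ` {1..n}"
  proof (intro equalityI subsetI)
    fix p assume p: "p \<in> K \<inter> planar_proj -` {c}"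
    then have "p \<in> K \<inter> planar_proj -` U"
      using U by auto
    then obtain i t where it: "i \<in> {1..n}" "t \<in> {-1<..<1}" "p = s i t"
      unfolding K by auto
    then have "t *\<^sub>R u i = 0"
      using s it p \<phi>(2) by auto
    then have "t = 0"
      using bspec[OF u it(1)] by auto
    then show "p \<in> (\<lambda>i. s i 0) ` {1..n}"
      using it by auto
  next
    fix p assume "p \<in> (\<lambda>i. s i 0) ` {1..n}"
    then obtain i where i: "i \<in> {1..n}" "p = s i 0"
      by auto
    then have p: "p \<in> K \<inter> planar_proj -` U"
      unfolding K by force
    have "\<phi> (planar_proj p) = \<phi> c"
      using s i \<phi>(2) by simp
    then have "planar_proj p = c"
      using p U \<phi>(1) unfolding homeomorphism_def by (metis IntD2 vimageD)
    then show "p \<in> K \<inter> planar_proj -` {c}"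
      using p by auto
  qed
  have inj: "inj_on (height \<circ> (\<lambda>i. s i 0)) {1..n}"
  proof (rule linorder_inj_onI)
    show "(height \<circ> (\<lambda>i. s i 0)) i \<noteq> (height \<circ> (\<lambda>i. s i 0)) j"
      if "i < j" "i \<in> {1..n}" "j \<in> {1..n}" for i j
      using h that by fastforce
  qed auto
  show "2 \<le> n"
    by (rule n)
  show "inj_on height (K \<inter> planar_proj -` {c})"
    unfolding fib using inj by (rule inj_on_imageI)
  show "card (K \<inter> planar_proj -` {c}) = n"
    unfolding fib using card_image[OF inj_on_imageI2[OF inj]] by simp
qed

text \<open>The heights over the crossing point are kept and interpolated linearly in between, so the local
  maxima are among the peaks of the cyclic sequence of these heights.\<close>

proposition ubercrossing_projection_few_maxima:
  assumes L: "L homeomorphic sphere (0::complex) 1" and "ubercrossing_projection n L"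
  obtains M where "ambient_isotopic L M" "finite (local_maxima M)"
    "2 * card (local_maxima M) \<le> n"
proof -
  obtain c where mc: "multi_crossing n L c"
    and inj: "inj_on planar_proj (L - planar_proj -` {c})"
    using assms(2) unfolding ubercrossing_projection_def by blast
  define P where "P = L \<inter> planar_proj -` {c}"
  have n: "2 \<le> n" and card_P: "card P = n" and inj_P: "inj_on height P"
    using multi_crossing_fibre[OF mc] by (auto simp: P_def)
  have fin_P: "finite P" "P \<noteq> {}"
    using card_P n by (auto intro: card_ge_0_finite)
  define p0 where "p0 = arg_min_on height P"
  have p0: "p0 \<in> P" "\<And>p. p \<in> P \<Longrightarrow> height p0 \<le> height p"
    using arg_min_if_finite[OF fin_P, of height] by (auto simp: p0_def not_less)
  obtain \<gamma> :: "real \<Rightarrow> real^3" where \<gamma>: "continuous_on {0..1} \<gamma>" "\<gamma> ` {0..1} = L"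
      "\<gamma> 0 = p0" "\<gamma> 1 = p0" and \<gamma>_inj: "inj_on \<gamma> {0..<1}"
    using homeomorphic_circle_imp_loop[OF L] p0(1) by (auto simp: P_def)
  define T where "T = {x \<in> {0..<1}. \<gamma> x \<in> P}"
  have img_T: "\<gamma> ` T = P"
  proof (intro equalityI subsetI)
    fix p assume "p \<in> P"
    then obtain x where x: "x \<in> {0..1}" "p = \<gamma> x"
      using \<gamma>(2) by (auto simp: P_def)
    then show "p \<in> \<gamma> ` T"
      using \<open>p \<in> P\<close> \<gamma>(3,4)
      by (cases "x = 1") (auto simp: T_def image_iff intro: bexI[of _ 0] bexI[of _ x])
  qed (auto simp: T_def)
  have inj_T: "inj_on \<gamma> T"
    using \<gamma>_inj by (rule inj_on_subset) (auto simp: T_def)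
  have fin_T: "finite T"
    using finite_imageD[OF _ inj_T] img_T fin_P by simp
  have "card T = n"
    using card_image[OF inj_T] img_T card_P by simp
  moreover have "1 \<notin> T"
    by (simp add: T_def)
  ultimately have card_T: "card (insert 1 T) = Suc n"
    using fin_T by simp
  obtain t where t: "strict_mono_on {..n} t" "t ` {..n} = insert 1 T" "t 0 = 0" "t n = 1"
  proof (rule finite_increasing_enumeration[of "insert 1 T" n 0 1])
    show "0 \<in> insert 1 T"
      using p0 \<gamma>(3) by (simp add: T_def)
    show "insert 1 T \<subseteq> {0..1}"
      by (auto simp: T_def)
  qed (use fin_T card_T in auto)
  have tt: "t i < t j" if "i < j" "j \<le> n" for i j
    using strict_mono_onD[OF t(1), of i j] that by auto
  have t_T: "t k \<in> T" if "k < n" for k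
  proof -
    have "t k \<in> insert 1 T"
      using t(2) that by auto
    then show ?thesis
      using tt[of k n] t(4) that by auto
  qed
  define v where "v = (\<lambda>k. height (\<gamma> (t k)))"
  have v_inj: "v i \<noteq> v j" if "i < j" "j < n" for i j
  proof -
    have "t i \<in> T" "t j \<in> T" "t i \<noteq> t j"
      using t_T that tt[of i j] by auto
    then have "\<gamma> (t i) \<noteq> \<gamma> (t j)" "\<gamma> (t i) \<in> P" "\<gamma> (t j) \<in> P"
      using inj_T by (auto simp: inj_on_def T_def)
    then show ?thesis
      using inj_P by (auto simp: inj_on_def v_def)
  qed
  have v_ends: "v n = v 0"
    using t \<gamma> by (simp add: v_def)
  \<comment> \<open>The last piece returns from \<open>v (n - 1)\<close> to \<open>v n = v 0\<close>; it is not level because a crossing has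
    at least two strands.\<close>
  have v_Suc: "v k \<noteq> v (Suc k)" if "k < n" for k
  proof (cases "Suc k = n")
    case True
    then show ?thesis
      using v_inj[of 0 k] v_ends n by auto
  next
    case False
    then show ?thesis
      using v_inj[of k "Suc k"] that by auto
  qed
  have low: "v 0 < v 1"
  proof -
    have "\<gamma> (t 1) \<in> P"
      using t_T[of 1] n by (simp add: T_def)
    then have "v 0 \<le> v 1"
      using p0(2) t(3) \<gamma>(3) by (simp add: v_def)
    then show ?thesis
      using v_Suc[of 0] n by simp
  qed
  obtain H where H: "continuous_on UNIV H" "\<And>k. k \<le> n \<Longrightarrow> H (t k) = v k"
    "\<And>k x. k < n \<Longrightarrow> x \<in> {t k..t (Suc k)} \<Longrightarrow>
       H x = v k + (v (Suc k) - v k) * ((x - t k) / (t (Suc k) - t k))"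
    using piecewise_linear_interpolation[OF t(1), of v] by blast
  have H_P: "H x = height (\<gamma> x)" if "x \<in> {0..1}" "\<gamma> x \<in> P" for x
  proof -
    have "x \<in> insert 1 T"
      using that by (auto simp: T_def)
    then obtain k where "k \<le> n" "x = t k"
      using t(2) by (metis atMost_iff imageE)
    then show ?thesis
      using H(2) by (simp add: v_def)
  qed
  have H_cont: "continuous_on {0..1} H"
    using H(1) by (rule continuous_on_subset) auto
  have fibre: "H x - height (\<gamma> x) = H y - height (\<gamma> y)"
    if xy: "x \<in> {0..1}" "y \<in> {0..1}" and eq: "planar_proj (\<gamma> x) = planar_proj (\<gamma> y)" for x y
  proof -
    have in_L: "\<gamma> x \<in> L" "\<gamma> y \<in> L"
      using xy \<gamma>(2) by auto
    show "H x - height (\<gamma> x) = H y - height (\<gamma> y)"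
    proof (cases "\<gamma> x \<in> P")
      case True
      then have "\<gamma> y \<in> P"
        using eq in_L by (auto simp: P_def)
      then show ?thesis
        using True H_P xy by simp
    next
      case False
      then have "\<gamma> x = \<gamma> y"
        using inj eq in_L by (auto simp: P_def inj_on_def)
      \<comment> \<open>The endpoints of the loop lie over the crossing.\<close>
      have "x \<noteq> 1" "y \<noteq> 1"
        using False \<open>\<gamma> x = \<gamma> y\<close> p0(1) \<gamma>(4) by metis+
      then have "x \<in> {0..<1}" "y \<in> {0..<1}"
        using xy by auto
      then have "x = y"
        using inj_onD[OF \<gamma>_inj \<open>\<gamma> x = \<gamma> y\<close>] by blast
      then show ?thesis
        by simp
    qed
  qed
  obtain F where F: "continuous_on UNIV F"
      "\<And>x. x \<in> {0..1} \<Longrightarrow> height (vertical_shear F (\<gamma> x)) = H x"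
    using vertical_shear_with_prescribed_heights[OF \<gamma>(1) H_cont compact_Icc] fibre by blast
  define G where "G = vertical_shear F \<circ> \<gamma>"
  have G: "continuous_on {0..1} G"
    unfolding G_def by (intro continuous_on_compose continuous_on_vertical_shear \<gamma>(1) F(1))
  have G_ends: "G 0 = G 1" and G_img: "G ` {0..1} = vertical_shear F ` L"
    using \<gamma>(2,3,4) by (auto simp: G_def image_comp[symmetric])
  let ?M = "G ` {0..1}"
  have sub: "local_maxima ?M \<subseteq> G ` t ` peaks n v"
  proof (rule local_maxima_piecewise_linear[OF t(1,3,4) G G_ends v_Suc low])
    fix k x assume k: "k < n" and x: "x \<in> {t k..t (Suc k)}"
    have "t k \<in> insert 1 T" "t (Suc k) \<in> insert 1 T"
      unfolding t(2)[symmetric] using k by auto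
    then have "0 \<le> t k" "t (Suc k) \<le> 1"
      by (auto simp: T_def)
    then have "x \<in> {0..1}"
      using x by auto
    then show "height (G x) = v k + (v (Suc k) - v k) * ((x - t k) / (t (Suc k) - t k))"
      using F(2)[of x] H(3)[OF k x] by (simp add: G_def)
  qed (use n in auto)
  have fin: "finite (peaks n v)"
    by (simp add: peaks_def)
  have "card (local_maxima ?M) \<le> card (G ` t ` peaks n v)"
    using sub fin by (intro card_mono) auto
  also have "\<dots> \<le> card (peaks n v)"
    using fin by (metis card_image_le finite_imageI le_trans)
  finally have "2 * card (local_maxima ?M) \<le> n"
    using two_card_peaks_le[of n v] by linarith
  moreover have "finite (local_maxima ?M)"
    using sub fin by (meson finite_imageI finite_subset)
  ultimately show thesis
    using that[of ?M] ambient_isotopic_vertical_shear[OF F(1), of L] by (simp add: G_img)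
qed

theorem lemma2p1:
  fixes K :: "(real^3) set"
  assumes "knot K"
  shows "ubercrossing_number K \<ge> 2 * bridge_number K"
proof -
  have "2 * bridge_number K \<le> enat n"
    if KL: "ambient_isotopic K L" and L: "ubercrossing_projection n L" for n L
  proof -
    have "L homeomorphic sphere (0::complex) 1"
      using assms ambient_isotopic_imp_homeomorphic[OF KL] homeomorphic_trans homeomorphic_sym
      unfolding knot_def by blast
    then obtain M where M: "ambient_isotopic L M" "finite (local_maxima M)"
        "2 * card (local_maxima M) \<le> n"
      using ubercrossing_projection_few_maxima L by blast
    have "bridge_number K \<le> enat (card (local_maxima M))"
      unfolding bridge_number_def
      by (rule INF_lower) (use ambient_isotopic_trans[OF KL M(1)] M(2) in simp)
    then have "2 * bridge_number K \<le> 2 * enat (card (local_maxima M))"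
      by (rule mult_left_mono) simp
    also have "\<dots> \<le> enat n"
      using M(3) by (simp add: numeral_eq_enat)
    finally show ?thesis .
  qed
  then show ?thesis
    unfolding ubercrossing_number_def by (auto intro!: INF_greatest)
qed

end
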